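(* Let $f\in C^{\infty}[a,b]$ (complex-valued), let $a=a_0<a_1<\dots<a_K=b$ be a partition of $I=[a,b]$ into $K$ subintervals $I_k=[a_{k-1},a_k]$, let $T>1$, $\Lambda=[0,\frac{2\pi}{T}]$, let $N$ be a non-negative integer, and let $\epsilon>0$. With $g_k$, $\mathcal{Q}_N^{\epsilon}$ and $\mathcal{P}_{N,K}^{\epsilon}$ as defined in the context, the local Fourier extension approximation $\mathcal{P}_{N,K}^{\epsilon}f$ satisfies $$\left\|f-\mathcal{P}_{N,K}^{\epsilon}f\right\|_{L^2(I)}\leq \sqrt{\frac{T}{2\pi}(b-a)}\ \max_{1\leq k\leq K}\left\{\left\|g_k-\mathcal{Q}_{N}^{\epsilon}g_k\right\|_{L^2(\Lambda)}\right\}.$$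
   Context: For $k=1,\dots,K$ put $s_k=\frac{T}{2\pi}(a_k-a_{k-1})$ and define $g_k:\Lambda\to\mathbb{C}$ by $g_k(t)=f(a_{k-1}+s_k t)$. $L^2(\Lambda)$ and $L^2(I)$ are taken with Lebesgue measure. For integers $\ell$ let $\phi_\ell(t)=e^{i\ell t}$, $t\in\Lambda$, and let $H_N=\mathrm{span}\{\phi_\ell:|\ell|\le N\}\subset L^2(\Lambda)$. Define the linear operator $\mathcal{F}_N:\mathbb{C}^{2N+1}\to H_N$ by $\mathcal{F}_N\mathbf{c}=\sum_{\ell=-N}^{N}c_\ell\phi_\ell$ for $\mathbf{c}=\{c_\ell\}_{|\ell|\le N}$, where $\mathbb{C}^{2N+1}$ carries the Euclidean ($\ell^2$) norm and $H_N$ the $L^2(\Lambda)$ norm. Let $(\sigma_j,v_j,u_j)$ be a singular system of $\mathcal{F}_N$: $\{v_j\}$ is an orthonormal basis of $\mathbb{C}^{2N+1}$, $\{u_j\}$ is an orthonormal basis of $H_N$ in $L^2(\Lambda)$, $\sigma_j>0$, and $\mathcal{F}_N v_j=\sigma_j u_j$. For $g\in L^2(\Lambda)$ define $\mathcal{Q}_N^{\epsilon}g=\sum_{\sigma_j>\epsilon}\langle g,u_j\rangle u_j$ (inner product of $L^2(\Lambda)$), i.e. the orthogonal projection of $L^2(\Lambda)$ onto $\mathrm{span}\{u_j:\sigma_j>\epsilon\}$. The local Fourier extension approximation of $f$ is the function on $I$ given by $(\mathcal{P}_{N,K}^{\epsilon}f)(x)=(\mathcal{Q}_N^{\epsilon}g_k)\left(\frac{x-a_{k-1}}{s_k}\right)$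 for $x\in I_k$, $k=1,\dots,K$ (the choice of value at the interior partition points is immaterial in $L^2(I)$). *)

theory Defs
  imports "HOL-Analysis.Analysis"
begin

text \<open>Elements of L2(S) are represented by functions; equality in L2(S) is equality
  almost everywhere on S. The norm and inner product carry their usual meaning for members of
  \<^term>\<open>L2\<close> only (the Bochner integral of a non-integrable function is 0 by convention).\<close>

definition L2 :: "real set \<Rightarrow> (real \<Rightarrow> complex) set" where
  "L2 S = {g. g \<in> borel_measurable (lebesgue_on S) \<and>
              integrable (lebesgue_on S) (\<lambda>x. (cmod (g x))\<^sup>2)}"

definition L2_eq :: "real set \<Rightarrow> (real \<Rightarrow> complex) \<Rightarrow> (real \<Rightarrow> complex) \<Rightarrow> bool" where
  "L2_eq S g h \<longleftrightarrow> (AE x in lebesgue_on S. g x = h x)"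

definition L2_inner :: "real set \<Rightarrow> (real \<Rightarrow> complex) \<Rightarrow> (real \<Rightarrow> complex) \<Rightarrow> complex" where
  "L2_inner S g h = (LINT x|lebesgue_on S. g x * cnj (h x))"

definition L2_norm :: "real set \<Rightarrow> (real \<Rightarrow> complex) \<Rightarrow> real" where
  "L2_norm S g = sqrt (LINT x|lebesgue_on S. (cmod (g x))\<^sup>2)"

text \<open>Derivatives of all orders on S, one-sided at end points of an interval; D n is the n-th
  derivative.\<close>

definition C_infinity_on :: "real set \<Rightarrow> (real \<Rightarrow> complex) \<Rightarrow> bool" where
  "C_infinity_on S f \<longleftrightarrow> (\<exists>D :: nat \<Rightarrow> real \<Rightarrow> complex. (\<forall>x\<in>S. D 0 x = f x) \<and>
     (\<forall>n. \<forall>x\<in>S. (D n has_vector_derivative D (Suc n) x) (at x within S)))"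

definition is_partition :: "real \<Rightarrow> real \<Rightarrow> nat \<Rightarrow> (nat \<Rightarrow> real) \<Rightarrow> bool" where
  "is_partition a b K p \<longleftrightarrow> 1 \<le> K \<and> p 0 = a \<and> p K = b \<and> (\<forall>k\<in>{1..K}. p (k - 1) < p k)"

definition Lam :: "real \<Rightarrow> real set" where
  "Lam T = {0..2 * pi / T}"

definition phi :: "int \<Rightarrow> real \<Rightarrow> complex" where
  "phi l t = exp (\<i> * of_int l * of_real t)"

text \<open>Vectors in complex (2N+1)-space are functions on the integers of which only the values
  at indices in \<open>{-N..N}\<close> are relevant.\<close>

definition cvec_inner :: "nat \<Rightarrow> (int \<Rightarrow> complex) \<Rightarrow> (int \<Rightarrow> complex) \<Rightarrow> complex" where
  "cvec_inner N c d = (\<Sum>l\<in>{- int N..int N}. c l * cnj (d l))"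

definition FN :: "nat \<Rightarrow> (int \<Rightarrow> complex) \<Rightarrow> real \<Rightarrow> complex" where
  "FN N c t = (\<Sum>l\<in>{- int N..int N}. c l * phi l t)"

definition HN :: "nat \<Rightarrow> real \<Rightarrow> (real \<Rightarrow> complex) set" where
  "HN N T = {h \<in> L2 (Lam T).
     \<exists>c. L2_eq (Lam T) h (\<lambda>t. \<Sum>l\<in>{- int N..int N}. c l * phi l t)}"

definition orthonormal_on :: "nat set \<Rightarrow> ('v \<Rightarrow> 'v \<Rightarrow> complex) \<Rightarrow> (nat \<Rightarrow> 'v) \<Rightarrow> bool" where
  "orthonormal_on J ip e \<longleftrightarrow> (\<forall>i\<in>J. \<forall>j\<in>J. ip (e i) (e j) = (if i = j then 1 else 0))"

definition onb_cvec :: "nat \<Rightarrow> (nat \<Rightarrow> int \<Rightarrow> complex) \<Rightarrow> bool" where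
  "onb_cvec N v \<longleftrightarrow> orthonormal_on {..2 * N} (cvec_inner N) v \<and>
     (\<forall>c. \<exists>d. \<forall>l\<in>{- int N..int N}. c l = (\<Sum>j\<le>2 * N. d j * v j l))"

definition onb_HN :: "nat \<Rightarrow> real \<Rightarrow> (nat \<Rightarrow> real \<Rightarrow> complex) \<Rightarrow> bool" where
  "onb_HN N T u \<longleftrightarrow> (\<forall>j\<le>2 * N. u j \<in> HN N T) \<and>
     orthonormal_on {..2 * N} (L2_inner (Lam T)) u \<and>
     (\<forall>h\<in>HN N T. \<exists>d. L2_eq (Lam T) h (\<lambda>t. \<Sum>j\<le>2 * N. d j * u j t))"

definition singular_system ::
  "nat \<Rightarrow> real \<Rightarrow> (nat \<Rightarrow> real) \<Rightarrow> (nat \<Rightarrow> int \<Rightarrow> complex) \<Rightarrow> (nat \<Rightarrow> real \<Rightarrow> complex) \<Rightarrow> bool"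
where
  "singular_system N T \<sigma> v u \<longleftrightarrow> onb_cvec N v \<and> onb_HN N T u \<and>
     (\<forall>j\<le>2 * N. \<sigma> j > 0 \<and> L2_eq (Lam T) (FN N (v j)) (\<lambda>t. of_real (\<sigma> j) * u j t))"

definition Q_proj ::
  "nat \<Rightarrow> real \<Rightarrow> (nat \<Rightarrow> real) \<Rightarrow> (nat \<Rightarrow> real \<Rightarrow> complex) \<Rightarrow> real \<Rightarrow>
   (real \<Rightarrow> complex) \<Rightarrow> real \<Rightarrow> complex"
where
  "Q_proj N T \<sigma> u \<epsilon> g t = (\<Sum>j\<in>{j. j \<le> 2 * N \<and> \<sigma> j > \<epsilon>}. L2_inner (Lam T) g (u j) * u j t)"

definition scale :: "real \<Rightarrow> (nat \<Rightarrow> real) \<Rightarrow> nat \<Rightarrow> real" where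
  "scale T p k = T / (2 * pi) * (p k - p (k - 1))"

definition local_fun ::
  "real \<Rightarrow> (nat \<Rightarrow> real) \<Rightarrow> (real \<Rightarrow> complex) \<Rightarrow> nat \<Rightarrow> real \<Rightarrow> complex" where
  "local_fun T p f k t = f (p (k - 1) + scale T p k * t)"

text \<open>The least k with \<open>x \<le> p k\<close> selects the subinterval containing x; at an interior partition
  point this is the interval on its left. That choice only affects a null set.\<close>

definition piece :: "(nat \<Rightarrow> real) \<Rightarrow> real \<Rightarrow> nat" where
  "piece p x = (LEAST k. 1 \<le> k \<and> x \<le> p k)"

definition local_FE ::
  "nat \<Rightarrow> real \<Rightarrow> (nat \<Rightarrow> real) \<Rightarrow> (nat \<Rightarrow> real \<Rightarrow> complex) \<Rightarrow> real \<Rightarrow> (nat \<Rightarrow> real) \<Rightarrow>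
   (real \<Rightarrow> complex) \<Rightarrow> real \<Rightarrow> complex"
where
  "local_FE N T \<sigma> u \<epsilon> p f x = (let k = piece p x in
     Q_proj N T \<sigma> u \<epsilon> (local_fun T p f k) ((x - p (k - 1)) / scale T p k))"

end

theory Submission
  imports Defs
begin

text \<open>The squared error integral over \<open>{a..b}\<close> is the sum of the integrals over
  the subintervals (\<open>integral_partition\<close>). On the k-th subinterval the approximation is
  by construction the rescaled local one, so the substitution x = \<open>p (k - 1)\<close> + s t
  with s = \<open>scale T p k\<close> turns that integral into s times the squared local error on
  \<open>Lam T\<close> (\<open>piece_eq\<close>, \<open>has_integral_rescaled\<close>). Bounding
  each local error by the maximum M leaves M^2 times the sum of the scales, which telescopes to T (b
  - a) / (2 pi). Splitting and substitution use the gauge integral; \<open>L2_norm_power2_eq\<close>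
  translates back to the Lebesgue integral in \<open>L2_norm\<close>.\<close>

lemma is_partition_mono:
  assumes "is_partition a b K p" "i \<le> j" "j \<le> K"
  shows "p i \<le> p j"
  using assms(2,3)
proof (induction j rule: dec_induct)
  case (step n)
  then have "p (Suc n - 1) < p (Suc n)"
    using assms(1) unfolding is_partition_def by fastforce
  with step show ?case by simp
qed simp

text \<open>Any \<open>j < k\<close> has \<open>p j \<le> p (k - 1) < x\<close>, so k is least. The
  left end point is excluded because \<open>piece\<close> gives an interior partition point to the
  interval on its left.\<close>

lemma piece_eq:
  assumes "is_partition a b K p" "k \<in> {1..K}" "p (k - 1) < x" "x \<le> p k"
  shows "piece p x = k"
  unfolding piece_def
proof (rule Least_equality)
  fix j assume j: "1 \<le> j \<and> x \<le> p j"
  show "k \<le> j"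
  proof (rule ccontr)
    assume "\<not> k \<le> j"
    then have "p j \<le> p (k - 1)"
      using is_partition_mono[OF assms(1)] assms(2) by simp
    with j assms(3) show False by simp
  qed
qed (use assms in auto)

text \<open>The upper limit \<open>p n\<close> with \<open>n \<le> K\<close> makes induction on n
  possible; only \<open>n = K\<close> is used later.\<close>

lemma integral_partition:
  fixes F :: "real \<Rightarrow> real"
  assumes "is_partition a b K p" "F integrable_on {a..b}" "n \<le> K"
  shows "integral {a..p n} F = (\<Sum>k\<in>{1..n}. integral {p (k - 1)..p k} F)"
  using assms(3)
proof (induction n)
  case 0
  then show ?case using assms(1) by (simp add: is_partition_def)
next
  case (Suc n)
  note mono = is_partition_mono[OF assms(1)]
  have le: "a \<le> p n" "p n \<le> p (Suc n)" "p (Suc n) \<le> b"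
    using mono[of 0 n] mono[of n "Suc n"] mono[of "Suc n" K] assms(1) Suc.prems
    by (auto simp: is_partition_def)
  have "F integrable_on {a..p (Suc n)}"
    by (rule integrable_subinterval_real[OF assms(2)]) (use le in auto)
  then show ?case
    using Henstock_Kurzweil_Integration.integral_combine[of a "p n" "p (Suc n)" F] le Suc
    by simp
qed

text \<open>Substitution x = c + s t; the factor 1 / s is the Jacobian.\<close>

lemma has_integral_rescaled:
  fixes G :: "real \<Rightarrow> real"
  assumes "s > 0" "((\<lambda>x. G ((x - c) / s)) has_integral I) {c..d}"
  shows "(G has_integral I / s) {0..(d - c) / s}"
  using has_integral_affinity'[of "\<lambda>x. G ((x - c) / s)" I c d s c] assms
  by (simp add: divide_simps)

text \<open>A nonnegative gauge-integrable function is absolutely integrable, so its Lebesgue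
  integral exists and has the same value.\<close>

lemma L2_norm_power2_eq:
  assumes "((\<lambda>x. (cmod (g x))\<^sup>2) has_integral I) {c..d}"
  shows "(L2_norm {c..d} g)\<^sup>2 = I"
proof -
  have "(\<lambda>x. (cmod (g x))\<^sup>2) absolutely_integrable_on {c..d}"
    by (rule nonnegative_absolutely_integrable_1) (use assms in auto)
  then have "integrable (lebesgue_on {c..d}) (\<lambda>x. (cmod (g x))\<^sup>2)"
    by (simp add: integrable_restrict_space set_integrable_def)
  then have "(LINT x|lebesgue_on {c..d}. (cmod (g x))\<^sup>2) = I"
    using assms by (simp add: lebesgue_integral_eq_integral integral_unique)
  then show ?thesis
    by (auto simp: L2_norm_def)
qed

lemma L2_norm_nonneg: "0 \<le> L2_norm S g"
  by (simp add: L2_norm_def)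

theorem theorem2p2:
  fixes f :: "real \<Rightarrow> complex" and a b T \<epsilon> :: real and N K :: nat
    and p :: "nat \<Rightarrow> real"
    and \<sigma> :: "nat \<Rightarrow> real" and v :: "nat \<Rightarrow> int \<Rightarrow> complex" and u :: "nat \<Rightarrow> real \<Rightarrow> complex"
  assumes "C_infinity_on {a..b} f"
    and "is_partition a b K p"
    and "T > 1"
    and "\<epsilon> > 0"
    and "singular_system N T \<sigma> v u"
  shows "L2_norm {a..b} (\<lambda>x. f x - local_FE N T \<sigma> u \<epsilon> p f x)
       \<le> sqrt (T / (2 * pi) * (b - a)) *
         Max ((\<lambda>k. L2_norm (Lam T)
                 (\<lambda>t. local_fun T p f k t - Q_proj N T \<sigma> u \<epsilon> (local_fun T p f k) t)) ` {1..K})"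
    (is "?lhs \<le> _ * Max (?E ` _)")
proof -
  note part = assms(2)
  define h where "h k t = local_fun T p f k t - Q_proj N T \<sigma> u \<epsilon> (local_fun T p f k) t" for k t
  define M where "M = Max (?E ` {1..K})"
  define F where "F x = (cmod (f x - local_FE N T \<sigma> u \<epsilon> p f x))\<^sup>2" for x
  have E: "?E k = L2_norm (Lam T) (h k)" for k
    by (simp add: h_def[abs_def])
  have EM: "?E k \<le> M" if "k \<in> {1..K}" for k
    unfolding M_def using that by (intro Max_ge) auto
  \<comment> \<open>A partition has at least one subinterval, so the maximum is over a nonempty set
    and inherits nonnegativity from one of its members.\<close>
  have "1 \<in> {1..K}" using part by (simp add: is_partition_def)
  from EM[OF this] have M0: "0 \<le> M"
    using L2_norm_nonneg order_trans by blast
  have ab: "p 0 = a" "p K = b" "a \<le> b"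
    using part is_partition_mono[OF part, of 0 K] by (auto simp: is_partition_def)
  have c0: "0 \<le> T / (2 * pi) * (b - a)"
    using assms(3) ab by simp
  have "?lhs \<le> sqrt (T / (2 * pi) * (b - a)) * M"
  proof (cases "integrable (lebesgue_on {a..b}) F")
    case False
    \<comment> \<open>The norm of a function that is not square integrable is 0.\<close>
    then have "?lhs = 0"
      by (simp add: L2_norm_def F_def[abs_def] not_integrable_integral_eq)
    then show ?thesis using c0 M0 by simp
  next
    case True
    then have int: "F integrable_on {a..b}"
      by (intro integrable_on_lebesgue_on) auto
    have piece_le: "integral {p (k - 1)..p k} F \<le> scale T p k * M\<^sup>2" if k: "k \<in> {1..K}" for k
    proof -
      define s where "s = scale T p k"
      have lt: "p (k - 1) < p k"
        using part k by (simp add: is_partition_def)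
      \<comment> \<open>The scale is chosen so that the subinterval is mapped exactly onto
        \<open>Lam T\<close>.\<close>
      then have s: "s > 0" and len: "(p k - p (k - 1)) / s = 2 * pi / T"
        using assms(3) by (auto simp: s_def scale_def field_simps)
      have sub: "{p (k - 1)..p k} \<subseteq> {a..b}"
        using is_partition_mono[OF part, of 0 "k - 1"] is_partition_mono[OF part, of k K] k ab
        by auto
      have "(F has_integral integral {p (k - 1)..p k} F) {p (k - 1)..p k}"
        using integrable_subinterval_real[OF int sub] by (rule integrable_integral)
      then have "((\<lambda>x. (cmod (h k ((x - p (k - 1)) / s)))\<^sup>2) has_integral
          integral {p (k - 1)..p k} F) {p (k - 1)..p k}"
      \<comment> \<open>At \<open>p (k - 1)\<close> the global approximation may use the preceding
        piece; changing the integrand at this one point leaves the integral unchanged.\<close>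
      proof (rule has_integral_spike_finite[of "{p (k - 1)}", rotated 2])
        fix x assume x: "x \<in> {p (k - 1)..p k} - {p (k - 1)}"
        then have "piece p x = k"
          by (intro piece_eq[OF part k]) auto
        then show "(cmod (h k ((x - p (k - 1)) / s)))\<^sup>2 = F x"
          using s by (simp add: F_def h_def local_FE_def local_fun_def s_def Let_def)
      qed auto
      from has_integral_rescaled[where G = "\<lambda>t. (cmod (h k t))\<^sup>2", OF s this]
      have "(?E k)\<^sup>2 = integral {p (k - 1)..p k} F / s"
        unfolding E unfolding Lam_def len by (rule L2_norm_power2_eq)
      then have "integral {p (k - 1)..p k} F = s * (?E k)\<^sup>2"
        using s by simp
      also have "\<dots> \<le> s * M\<^sup>2"
        using s EM[OF k] by (intro mult_left_mono power_mono L2_norm_nonneg) auto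
      finally show ?thesis
        by (simp only: s_def)
    qed
    have "?lhs\<^sup>2 = integral {a..b} F"
      using int by (intro L2_norm_power2_eq) (simp add: F_def[abs_def] integrable_integral)
    also have "\<dots> = (\<Sum>k\<in>{1..K}. integral {p (k - 1)..p k} F)"
      using integral_partition[OF part int, of K] ab by simp
    also have "\<dots> \<le> (\<Sum>k\<in>{1..K}. scale T p k * M\<^sup>2)"
      by (intro sum_mono piece_le)
    also have "\<dots> = T / (2 * pi) * (\<Sum>k\<in>{1..K}. p k - p (k - 1)) * M\<^sup>2"
      by (simp add: scale_def sum_distrib_left sum_distrib_right)
    \<comment> \<open>The subinterval lengths telescope, so the constant does not depend on
      K.\<close>
    also have "(\<Sum>k\<in>{1..K}. p k - p (k - 1)) = b - a"
      using sum_telescope''[of 0 K p] ab by simp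
    also have "T / (2 * pi) * (b - a) * M\<^sup>2 = (sqrt (T / (2 * pi) * (b - a)) * M)\<^sup>2"
      using c0 by (simp add: power_mult_distrib)
    finally show ?thesis
      by (rule power2_le_imp_le) (use c0 M0 in simp)
  qed
  then show ?thesis by (simp only: M_def)
qed

end
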